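(* Let $a$ be an even positive integer and fix $\epsilon_1\ge 0$ independent of $n$. Place $n$ sensors on $[0,\infty)$ at the first $n$ arrival times $X_1\le X_2\le\dots\le X_n$ of a homogeneous Poisson process on $[0,\infty)$ with rate $n$. Consider algorithm $MV_1(n,s)$ with $s=\frac{1+\epsilon_1}{n}$: the first sensor stays at $X_1$ and, for $i=2,\dots,n$, the sensor at $X_i$ is moved to the position $X_1+(i-1)s$. Then, as $n\to\infty$, the expected $a$-total movement $\mathbf{E}\left[\sum_{i=2}^n |X_i-X_1-(i-1)s|^a\right]$ of this algorithm equals $$\frac{a!}{2^{a/2}\left(\frac{a}{2}+1\right)!}\,n^{1-\frac{a}{2}}+O\!\left(n^{-\frac{a}{2}}\right)\quad\text{if }\epsilon_1=0,$$ and is $\Theta(n)$ if $\epsilon_1>0$.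
   Context: If the $i$-th sensor is displaced by a distance $|m(i)|$, the $a$-total movement is $\sum_{i=1}^n|m(i)|^a$. Asymptotic notation refers to $n\to\infty$ with $a,\epsilon_1$ fixed. *)

theory Defs
  imports "HOL-Probability.Probability" "HOL-Library.Landau_Symbols"
begin

(* Sequences of points are indexed from 1: X i is the i-th arrival time for i \<ge> 1,
   and the value X 0 plays no role. *)

definition arrivals_in :: "(nat \<Rightarrow> 'w \<Rightarrow> real) \<Rightarrow> real set \<Rightarrow> 'w \<Rightarrow> nat" where
  "arrivals_in X B \<omega> = card {i. 1 \<le> i \<and> X i \<omega> \<in> B}"

(* X lists, in nondecreasing order, the arrival times of a homogeneous Poisson process on
   [0,\<infinity>).  arrivals_in X {s<..t} is the increment N(t) - N(s) of the counting process
   N(t) = #{i \<ge> 1. X i \<le> t}; the finiteness of N(t), which makes the use of card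
   meaningful, is the assumption locally_finite, and N(0) = 0 is no_arrival_at_0. *)

locale poisson_arrivals = prob_space M
  for M :: "'w measure" and rate :: real and X :: "nat \<Rightarrow> 'w \<Rightarrow> real" +
  assumes rate_pos: "rate > 0"
    and arrival_measurable: "\<And>i. 1 \<le> i \<Longrightarrow> random_variable borel (X i)"
    and arrival_nonneg: "AE \<omega> in M. \<forall>i\<ge>1. 0 \<le> X i \<omega>"
    and arrival_mono: "AE \<omega> in M. \<forall>i\<ge>1. X i \<omega> \<le> X (Suc i) \<omega>"
    and locally_finite: "AE \<omega> in M. \<forall>t. finite {i. 1 \<le> i \<and> X i \<omega> \<le> t}"
    and no_arrival_at_0: "AE \<omega> in M. arrivals_in X {0} \<omega> = 0"
    and poisson_increments:
      "\<And>s t. 0 \<le> s \<Longrightarrow> s < t \<Longrightarrow>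
         distr M (count_space UNIV) (arrivals_in X {s<..t})
           = measure_pmf (poisson_pmf (rate * (t - s)))"
    and independent_increments:
      "\<And>(\<tau> :: nat \<Rightarrow> real) k. 0 \<le> \<tau> 0 \<Longrightarrow> (\<forall>j<k. \<tau> j < \<tau> (Suc j)) \<Longrightarrow>
         indep_vars (\<lambda>_. count_space UNIV) (\<lambda>j. arrivals_in X {\<tau> j<..\<tau> (Suc j)}) {..<k}"

definition mv1 :: "real \<Rightarrow> (nat \<Rightarrow> real) \<Rightarrow> nat \<Rightarrow> real" where
  "mv1 s x i = (if i = 1 then x 1 else x 1 + (real i - 1) * s)"

definition total_movement :: "nat \<Rightarrow> nat \<Rightarrow> (nat \<Rightarrow> real) \<Rightarrow> (nat \<Rightarrow> real) \<Rightarrow> real" where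
  "total_movement a n x y = (\<Sum>i=1..n. \<bar>x i - y i\<bar> ^ a)"

lemma total_movement_mv1:
  assumes "a > 0"
  shows "total_movement a n x (mv1 s x) = (\<Sum>i=2..n. \<bar>x i - x 1 - (real i - 1) * s\<bar> ^ a)"
proof -
  have "total_movement a n x (mv1 s x) = (\<Sum>i=2..n. \<bar>x i - mv1 s x i\<bar> ^ a)"
    unfolding total_movement_def
    by (rule sum.mono_neutral_right)
      (use assms in \<open>auto simp: mv1_def not_le less_Suc_eq numeral_2_eq_2\<close>)
  also have "\<dots> = (\<Sum>i=2..n. \<bar>x i - x 1 - (real i - 1) * s\<bar> ^ a)"
    by (rule sum.cong) (auto simp: mv1_def algebra_simps)
  finally show ?thesis .
qed

end

theory Submission
  imports Defs "HOL-Real_Asymp.Real_Asymp"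
begin

text \<open>The gap \<open>X\<^bsub>k+2\<^esub> - X\<^sub>1\<close> has the Erlang distribution of shape \<open>k + 1\<close>. To see this from the
  counting process, locate \<open>X\<^sub>1\<close> on a grid of mesh \<open>h\<close> and use independence of the increments
  before, in and after its cell; as \<open>h\<close> tends to 0 this gives lower bounds for the
  probabilities that the gap is \<open>> u\<close> and \<open>\<le> u\<close> which add up to 1, so both are equalities.
  After scaling by the rate, the expected movement is \<open>n\<^bsup>-a\<^esup>\<close> times the sum over \<open>1 \<le> \<kappa> < n\<close> of
  the \<open>a\<close>-th moment about \<open>(1 + \<epsilon>\<^sub>1) \<kappa>\<close> of a Gamma variable of shape \<open>\<kappa>\<close>. For \<open>\<epsilon>\<^sub>1 = 0\<close>
  Stein's identity gives \<open>a! / (2\<^bsup>a/2\<^esup> (a/2)!) \<kappa>\<^bsup>a/2\<^esup> + O(\<kappa>\<^bsup>a/2 - 1\<^esup>)\<close> for this moment. For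
  \<open>\<epsilon>\<^sub>1 > 0\<close> it is \<open>O(\<kappa>\<^sup>a)\<close>, and at least \<open>(\<epsilon>\<^sub>1 \<kappa>)\<^sup>a\<close> by Jensen's inequality.\<close>

section \<open>Arrival times and counts\<close>

lemma arrivals_in_add:
  assumes "\<forall>t. finite {i. 1 \<le> i \<and> X i \<omega> \<le> t}" and "r \<le> s" "s \<le> t"
  shows "arrivals_in X {r<..t} \<omega> = arrivals_in X {r<..s} \<omega> + arrivals_in X {s<..t} \<omega>"
proof -
  have eq: "{i. 1 \<le> i \<and> X i \<omega> \<in> {r<..t}}
      = {i. 1 \<le> i \<and> X i \<omega> \<in> {r<..s}} \<union> {i. 1 \<le> i \<and> X i \<omega> \<in> {s<..t}}"
    using assms(2,3) by auto
  have "finite {i. 1 \<le> i \<and> X i \<omega> \<le> t}"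
    using assms(1) by blast
  then have "finite {i. 1 \<le> i \<and> X i \<omega> \<in> {r<..s}}" "finite {i. 1 \<le> i \<and> X i \<omega> \<in> {s<..t}}"
    using assms(2,3) by (auto elim!: finite_subset[rotated])
  then show ?thesis
    unfolding arrivals_in_def eq by (intro card_Un_disjoint) auto
qed

text \<open>By monotonicity the indices with \<open>X i \<omega> \<le> t\<close> form an initial
  segment, and strict positivity lets the count over \<open>{0<..t}\<close> see all of them.\<close>

lemma arrival_le_iff:
  assumes pos: "\<forall>i\<ge>1. 0 < X i \<omega>" and mono: "\<forall>i\<ge>1. X i \<omega> \<le> X (Suc i) \<omega>"
    and fin: "\<forall>t. finite {i. 1 \<le> i \<and> X i \<omega> \<le> t}" and "1 \<le> m"
  shows "X m \<omega> \<le> t \<longleftrightarrow> m \<le> arrivals_in X {0<..t} \<omega>"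
proof -
  have le: "X i \<omega> \<le> X j \<omega>" if "1 \<le> i" "i \<le> j" for i j
    using that(2)
  proof (induction rule: dec_induct)
    case (step n)
    with mono \<open>1 \<le> i\<close> show ?case
      by (meson order_trans)
  qed simp
  have eq: "{i. 1 \<le> i \<and> X i \<omega> \<in> {0<..t}} = {i. 1 \<le> i \<and> X i \<omega> \<le> t}"
    using pos by auto
  have fin': "finite {i. 1 \<le> i \<and> X i \<omega> \<le> t}"
    using fin by blast
  show ?thesis
  proof
    assume "X m \<omega> \<le> t"
    then have "{1..m} \<subseteq> {i. 1 \<le> i \<and> X i \<omega> \<le> t}"
      by (auto intro: order_trans[OF le])
    from card_mono[OF fin' this] show "m \<le> arrivals_in X {0<..t} \<omega>"
      unfolding arrivals_in_def eq by simp
  next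
    assume m: "m \<le> arrivals_in X {0<..t} \<omega>"
    show "X m \<omega> \<le> t"
    proof (rule ccontr)
      assume "\<not> X m \<omega> \<le> t"
      then have "{i. 1 \<le> i \<and> X i \<omega> \<le> t} \<subseteq> {1..<m}"
        using le[OF \<open>1 \<le> m\<close>] by (force simp: not_le[symmetric])
      from card_mono[OF _ this] show False
        using m \<open>1 \<le> m\<close> unfolding arrivals_in_def eq by simp
    qed
  qed
qed

section \<open>The law of the gap after the first arrival\<close>

context poisson_arrivals
begin

lemma AE_regular:
  "AE \<omega> in M. (\<forall>i\<ge>1. 0 < X i \<omega>) \<and> (\<forall>i\<ge>1. X i \<omega> \<le> X (Suc i) \<omega>)
     \<and> (\<forall>t. finite {i. 1 \<le> i \<and> X i \<omega> \<le> t})"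
  using arrival_nonneg arrival_mono locally_finite no_arrival_at_0
proof eventually_elim
  case (elim \<omega>)
  have "finite {i. 1 \<le> i \<and> X i \<omega> \<le> 0}"
    using elim(3) by blast
  then have "finite {i. 1 \<le> i \<and> X i \<omega> \<in> {0}}"
    by (rule finite_subset[rotated]) auto
  \<comment> \<open>Finiteness matters: \<open>card\<close> is also 0 on infinite sets, so a
    vanishing count alone would not exclude arrivals at 0.\<close>
  with elim(4) have "\<forall>i\<ge>1. X i \<omega> \<noteq> 0"
    unfolding arrivals_in_def by (subst (asm) card_0_eq) auto
  with elim show ?case
    by (auto simp: order_less_le)
qed

lemma indep_three_increments:
  assumes "0 \<le> r" "r < s" "s < t" "t < u"
  shows "prob {\<omega> \<in> space M. arrivals_in X {r<..s} \<omega> \<in> A \<and> arrivals_in X {s<..t} \<omega> \<in> B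
                \<and> arrivals_in X {t<..u} \<omega> \<in> C}
       = measure (poisson_pmf (rate * (s - r))) A * measure (poisson_pmf (rate * (t - s))) B
           * measure (poisson_pmf (rate * (u - t))) C" (is "prob ?L = _")
    and "{\<omega> \<in> space M. arrivals_in X {r<..s} \<omega> \<in> A \<and> arrivals_in X {s<..t} \<omega> \<in> B
                \<and> arrivals_in X {t<..u} \<omega> \<in> C} \<in> events"
proof -
  define \<tau> where "\<tau> = (\<lambda>j::nat. if j = 0 then r else if j = 1 then s else if j = 2 then t else u)"
  define S where "S = (\<lambda>j::nat. if j = 0 then A else if j = 1 then B else C)"
  have I: "indep_vars (\<lambda>_. count_space UNIV) (\<lambda>j. arrivals_in X {\<tau> j<..\<tau> (Suc j)}) {..<3}"
    using assms by (intro independent_increments) (auto simp: \<tau>_def)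
  have three: "{..<3::nat} = {0, 1, 2}" by auto
  have ne: "{..<3::nat} \<noteq> {}" unfolding three by blast
  have rv: "arrivals_in X {\<tau> j<..\<tau> (Suc j)} \<in> measurable M (count_space UNIV)" if "j < 3" for j
    using I that by (auto simp: indep_vars_def)
  have eq: "?L = (\<Inter>j\<in>{..<3}. arrivals_in X {\<tau> j<..\<tau> (Suc j)} -` S j \<inter> space M)"
    by (auto simp: three \<tau>_def S_def)
  show "?L \<in> events"
    unfolding eq
  proof (rule sets.finite_INT)
    fix j :: nat assume "j \<in> {..<3}"
    then show "arrivals_in X {\<tau> j<..\<tau> (Suc j)} -` S j \<inter> space M \<in> events"
      using rv by (intro measurable_sets[where A = "count_space UNIV"]) auto
  qed (use ne in auto)
  have pois: "prob (arrivals_in X {\<tau> j<..\<tau> (Suc j)} -` S j \<inter> space M)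
      = measure (poisson_pmf (rate * (\<tau> (Suc j) - \<tau> j))) (S j)" if "j < 3" for j
  proof -
    have "0 \<le> \<tau> j" "\<tau> j < \<tau> (Suc j)"
      using assms that by (auto simp: \<tau>_def)
    then show ?thesis
      using rv[OF that] by (simp add: poisson_increments[symmetric] measure_distr)
  qed
  have "prob ?L = (\<Prod>j\<in>{..<3}. prob (arrivals_in X {\<tau> j<..\<tau> (Suc j)} -` S j \<inter> space M))"
    unfolding eq using I by (rule indep_varsD) (use ne in auto)
  also have "\<dots> = (\<Prod>j\<in>{..<3}. measure (poisson_pmf (rate * (\<tau> (Suc j) - \<tau> j))) (S j))"
    using pois by (intro prod.cong) auto
  also have "\<dots> = measure (poisson_pmf (rate * (s - r))) A * measure (poisson_pmf (rate * (t - s))) B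
           * measure (poisson_pmf (rate * (u - t))) C"
    by (simp add: three \<tau>_def S_def)
  finally show "prob ?L = \<dots>" .
qed

text \<open>Only cells with exactly one arrival are kept: the probability lost to cells with several
  arrivals vanishes with the mesh \<open>h\<close>, as \<open>cell_weight_tendsto_1\<close> below shows.\<close>

definition first_arrival_cell :: "real \<Rightarrow> real \<Rightarrow> nat set \<Rightarrow> nat \<Rightarrow> 'w set" where
  "first_arrival_cell h u S j = {\<omega> \<in> space M. arrivals_in X {0<..real (j + 1) * h} \<omega> \<in> {0}
     \<and> arrivals_in X {real (j + 1) * h<..real (j + 2) * h} \<omega> \<in> {1}
     \<and> arrivals_in X {real (j + 2) * h<..real (j + 2) * h + u} \<omega> \<in> S}"

text \<open>Only the void probability of \<open>{0<..real (j + 1) * h}\<close> depends on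
  \<open>j\<close>, and it is a power of \<open>exp (- rate * h)\<close>; so the values form a
  geometric sequence.\<close>

lemma prob_first_arrival_cell:
  assumes "h > 0" "u > 0"
  shows "prob (first_arrival_cell h u S j)
       = rate * h * exp (- 2 * rate * h) * measure (poisson_pmf (rate * u)) S * exp (- rate * h) ^ j"
    and "first_arrival_cell h u S j \<in> events"
proof -
  \<comment> \<open>The index shift in the cells keeps the initial interval nondegenerate for
    \<open>j = 0\<close>, as the increment assumptions ask for strict inequalities. The skipped
    interval \<open>{0<..h}\<close> costs nothing in the limit.\<close>
  have "0 < real (j + 1) * h" "real (j + 1) * h < real (j + 2) * h"
       "real (j + 2) * h < real (j + 2) * h + u"
    using assms by auto
  note * = indep_three_increments[OF order_refl this, of "{0}" "{1}" S]
  show "first_arrival_cell h u S j \<in> events"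
    unfolding first_arrival_cell_def by (rule *(2))
  have gap: "real (j + 2) * h - real (j + 1) * h = h"
    "real (j + 2) * h + u - real (j + 2) * h = u" "real (j + 1) * h - 0 = real (j + 1) * h"
    by (simp_all add: algebra_simps)
  have "prob (first_arrival_cell h u S j) = exp (- (rate * (real (j + 1) * h)))
      * (rate * h * exp (- (rate * h))) * measure (poisson_pmf (rate * u)) S"
    unfolding first_arrival_cell_def *(1) gap using assms rate_pos
    by (simp add: measure_pmf_single)
  also have "exp (- (rate * (real (j + 1) * h))) = exp (- rate * h) * exp (- rate * h) ^ j"
    by (simp add: exp_of_nat_mult[symmetric] exp_add[symmetric] algebra_simps)
  also have "exp (- rate * h) * exp (- rate * h) ^ j * (rate * h * exp (- (rate * h)))
      * measure (poisson_pmf (rate * u)) S = rate * h * (exp (- rate * h) * exp (- rate * h))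
      * measure (poisson_pmf (rate * u)) S * exp (- rate * h) ^ j"
    by (simp add: ac_simps)
  also have "exp (- rate * h) * exp (- rate * h) = exp (- 2 * rate * h)"
    by (simp add: exp_add[symmetric])
  finally show "prob (first_arrival_cell h u S j)
     = rate * h * exp (- 2 * rate * h) * measure (poisson_pmf (rate * u)) S * exp (- rate * h) ^ j" .
qed

text \<open>The geometric series over all cells without the factor for \<open>S\<close>: for
  \<open>h > 0\<close>, the probability that the first arrival comes after \<open>h\<close> and is
  alone in its cell.\<close>

definition cell_weight :: "real \<Rightarrow> real" where
  "cell_weight h = rate * h * exp (- 2 * rate * h) / (1 - exp (- rate * h))"

text \<open>Put \<open>x = rate * h\<close>; near 0 the denominator \<open>1 - exp (- x)\<close>
  behaves like \<open>x\<close>.\<close>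

lemma cell_weight_tendsto_1: "(\<lambda>n. cell_weight (1 / real (Suc n))) \<longlonglongrightarrow> 1"
proof -
  have "((\<lambda>x::real. x * exp (- 2 * x) / (1 - exp (- x))) \<longlongrightarrow> 1) (at_right 0)"
    by real_asymp
  moreover have "filterlim (\<lambda>n. rate * (1 / real (Suc n))) (at_right 0) sequentially"
    using rate_pos by real_asymp
  ultimately show ?thesis
    unfolding cell_weight_def by (auto dest: filterlim_compose simp: mult.assoc)
qed

text \<open>Grid interval \<open>i\<close> contains an arrival but lies in the interval that must be
  empty for cell \<open>j\<close>. This holds almost surely, since additivity of counts rests on
  local finiteness.\<close>

lemma first_arrival_cells_disjoint:
  assumes "h > 0" "i < j"
  shows "AE \<omega> in M. \<omega> \<notin> first_arrival_cell h u S i \<or> \<omega> \<notin> first_arrival_cell h u S j"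
  using AE_regular
proof eventually_elim
  case (elim \<omega>)
  have "real (i + 2) * h \<le> real (j + 1) * h"
    using assms by (intro mult_right_mono) auto
  then have "arrivals_in X {0<..real (j + 1) * h} \<omega> \<ge> arrivals_in X {real (i + 1) * h<..real (i + 2) * h} \<omega>"
    using assms elim
    arrivals_in_add[of X \<omega> 0 "real (i + 1) * h" "real (i + 2) * h"]
    arrivals_in_add[of X \<omega> 0 "real (i + 2) * h" "real (j + 1) * h"]
    by (simp add: mult_right_mono)
  then show ?case
    by (auto simp: first_arrival_cell_def)
qed

text \<open>The cells are almost surely disjoint and contained in \<open>D\<close>, so each partial
  sum of their probabilities is at most \<open>prob D\<close>; the left-hand side is the full
  geometric series.\<close>

lemma prob_ge_if_cells_imp:
  assumes h: "h > 0" and u: "u > 0" and D: "D \<in> events"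
    and imp: "\<And>j. AE \<omega> in M. \<omega> \<in> first_arrival_cell h u S j \<longrightarrow> \<omega> \<in> D"
  shows "cell_weight h * measure (poisson_pmf (rate * u)) S \<le> prob D"
proof -
  let ?c = "rate * h * exp (- 2 * rate * h) * measure (poisson_pmf (rate * u)) S"
  note p = prob_first_arrival_cell[OF h u]
  have "norm (exp (- rate * h)) < 1"
    using h rate_pos by simp
  from sums_mult[OF geometric_sums[OF this], of ?c]
  have sums: "(\<lambda>j. prob (first_arrival_cell h u S j)) sums
      (cell_weight h * measure (poisson_pmf (rate * u)) S)"
    by (simp add: p cell_weight_def)
  have "(\<Sum>j<n. prob (first_arrival_cell h u S j)) \<le> prob D" for n
  proof -
    have "pairwise (\<lambda>i j. AE \<omega> in M. \<omega> \<notin> first_arrival_cell h u S i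
        \<or> \<omega> \<notin> first_arrival_cell h u S j) {..<n}"
      unfolding pairwise_def
    proof (intro ballI impI)
      fix i j :: nat assume "i \<noteq> j"
      then show "AE \<omega> in M. \<omega> \<notin> first_arrival_cell h u S i \<or> \<omega> \<notin> first_arrival_cell h u S j"
        using first_arrival_cells_disjoint[OF h, of i j u S]
          first_arrival_cells_disjoint[OF h, of j i u S]
        by (cases "i < j") (auto simp: disj_commute)
    qed
    then have "(\<Sum>j<n. prob (first_arrival_cell h u S j)) = prob (\<Union>j<n. first_arrival_cell h u S j)"
      using p(2) by (intro measure_UNION_AE[symmetric]) (auto simp: fmeasurable_eq_sets)
    also have "AE \<omega> in M. \<forall>j. \<omega> \<in> first_arrival_cell h u S j \<longrightarrow> \<omega> \<in> D"
      unfolding AE_all_countable using imp by blast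
    then have "prob (\<Union>j<n. first_arrival_cell h u S j) \<le> prob D"
      using D by (intro finite_measure_mono_AE) auto
    finally show ?thesis .
  qed
  then show ?thesis
    using sums unfolding sums_def by (intro LIMSEQ_le_const2) auto
qed

text \<open>The cell pins \<open>X 1\<close> to an interval of length \<open>h\<close>, and the
  window of length \<open>u\<close> starts at its right end. Hence the lower bound \<open>u\<close>
  is exact and only the upper bound loses \<open>h\<close>.\<close>

lemma gap_in_first_arrival_cell:
  assumes h: "h > 0" and u: "u > 0"
  shows "AE \<omega> in M. \<omega> \<in> first_arrival_cell h u {..k} j \<longrightarrow> u < X (k + 2) \<omega> - X 1 \<omega>"
    and "AE \<omega> in M. \<omega> \<in> first_arrival_cell h u {k<..} j \<longrightarrow> X (k + 2) \<omega> - X 1 \<omega> \<le> u + h"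
proof -
  let ?s = "real (j + 1) * h" and ?t = "real (j + 2) * h"
  have bounds: "?s < X 1 \<omega> \<and> X 1 \<omega> \<le> ?t \<and>
      (X (k + 2) \<omega> \<le> ?t + u \<longleftrightarrow> k < arrivals_in X {?t<..?t + u} \<omega>)"
    if reg: "\<forall>i\<ge>1. 0 < X i \<omega>" "\<forall>i\<ge>1. X i \<omega> \<le> X (Suc i) \<omega>"
         "\<forall>t. finite {i. 1 \<le> i \<and> X i \<omega> \<le> t}" and cell: "\<omega> \<in> first_arrival_cell h u S j" for \<omega> S
  proof -
    have le: "0 \<le> ?s" "?s \<le> ?t" "?t \<le> ?t + u" "0 \<le> ?t"
      using h u by (auto intro: mult_right_mono)
    have "arrivals_in X {0<..?t} \<omega> = 1" 
      using cell arrivals_in_add[where X = X and \<omega> = \<omega>, OF reg(3) le(1,2)] by (simp add: first_arrival_cell_def)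
    \<comment> \<open>The single arrival up to \<open>?t\<close> is \<open>X 1\<close>, so
      \<open>X (k + 2) \<omega> \<le> ?t + u\<close> asks for \<open>k + 1\<close> further arrivals
      in the window.\<close>
    moreover from this have "arrivals_in X {0<..?t + u} \<omega> = 1 + arrivals_in X {?t<..?t + u} \<omega>"
      using arrivals_in_add[where X = X and \<omega> = \<omega>, OF reg(3) le(4,3)] by simp
    moreover have "arrivals_in X {0<..?s} \<omega> = 0"
      using cell by (simp add: first_arrival_cell_def)
    ultimately show ?thesis
      using arrival_le_iff[where X = X and \<omega> = \<omega>, OF reg, of 1 ?s] arrival_le_iff[where X = X and \<omega> = \<omega>, OF reg, of 1 ?t]
        arrival_le_iff[where X = X and \<omega> = \<omega>, OF reg, of "k + 2" "?t + u"]
      by auto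
  qed
  have "?t = ?s + h"
    by (simp add: algebra_simps)
  have *: "arrivals_in X {?t<..?t + u} \<omega> \<in> S" if "\<omega> \<in> first_arrival_cell h u S j" for \<omega> S
    using that unfolding first_arrival_cell_def by blast
  show "AE \<omega> in M. \<omega> \<in> first_arrival_cell h u {..k} j \<longrightarrow> u < X (k + 2) \<omega> - X 1 \<omega>"
    using AE_regular
  proof (eventually_elim, intro impI)
    fix \<omega> assume "(\<forall>i\<ge>1. 0 < X i \<omega>) \<and> (\<forall>i\<ge>1. X i \<omega> \<le> X (Suc i) \<omega>)
       \<and> (\<forall>t. finite {i. 1 \<le> i \<and> X i \<omega> \<le> t})" and c: "\<omega> \<in> first_arrival_cell h u {..k} j"
    then show "u < X (k + 2) \<omega> - X 1 \<omega>"
      using bounds[of \<omega> "{..k}"] *[OF c] by auto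
  qed
  show "AE \<omega> in M. \<omega> \<in> first_arrival_cell h u {k<..} j \<longrightarrow> X (k + 2) \<omega> - X 1 \<omega> \<le> u + h"
    using AE_regular
  proof (eventually_elim, intro impI)
    fix \<omega> assume "(\<forall>i\<ge>1. 0 < X i \<omega>) \<and> (\<forall>i\<ge>1. X i \<omega> \<le> X (Suc i) \<omega>)
       \<and> (\<forall>t. finite {i. 1 \<le> i \<and> X i \<omega> \<le> t})" and c: "\<omega> \<in> first_arrival_cell h u {k<..} j"
    then show "X (k + 2) \<omega> - X 1 \<omega> \<le> u + h"
      using bounds[of \<omega> "{k<..}"] *[OF c] \<open>?t = ?s + h\<close> by auto
  qed
qed

text \<open>\<open>erlang_CDF\<close> is defined as one minus a Poisson sum: the wait for
  \<open>k + 1\<close> arrivals exceeds \<open>u\<close> exactly when at most \<open>k\<close> occur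
  up to \<open>u\<close>.\<close>

lemma measure_poisson_eq_erlang_CDF:
  assumes "u > 0"
  shows "measure (poisson_pmf (rate * u)) {..k} = 1 - erlang_CDF k rate u"
    and "measure (poisson_pmf (rate * u)) {k<..} = erlang_CDF k rate u"
proof -
  show *: "measure (poisson_pmf (rate * u)) {..k} = 1 - erlang_CDF k rate u"
    using assms rate_pos
    by (simp add: measure_measure_pmf_finite erlang_CDF_def field_simps)
  have "{k<..} = UNIV - {..k}"
    by auto
  then show "measure (poisson_pmf (rate * u)) {k<..} = erlang_CDF k rate u"
    using measure_pmf.prob_compl[of "{..k}" "poisson_pmf (rate * u)"] * by simp
qed

lemma erlang_gap: "distributed M lborel (\<lambda>\<omega>. X (k + 2) \<omega> - X 1 \<omega>) (erlang_density k rate)"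
proof -
  let ?Y = "\<lambda>\<omega>. X (k + 2) \<omega> - X 1 \<omega>"
  have [measurable]: "random_variable borel (X (k + 2))" "random_variable borel (X 1)"
    by (auto intro: arrival_measurable)
  have events: "{\<omega> \<in> space M. u < ?Y \<omega>} \<in> events" "{\<omega> \<in> space M. ?Y \<omega> \<le> u} \<in> events" for u
    by measurable
  have CDF: "prob {\<omega> \<in> space M. ?Y \<omega> \<le> u} = erlang_CDF k rate u" if u: "u > 0" for u
  proof (rule antisym)
    \<comment> \<open>The factor 1 is the limit of \<open>cell_weight\<close>. The complement of
      this tail bound gives the upper bound on the distribution function.\<close>
    have "1 * (1 - erlang_CDF k rate u) \<le> prob {\<omega> \<in> space M. u < ?Y \<omega>}"
    proof (rule LIMSEQ_le_const2[OF tendsto_mult_right[OF cell_weight_tendsto_1]])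
      have "cell_weight (1 / real (Suc n)) * measure (poisson_pmf (rate * u)) {..k}
          \<le> prob {\<omega> \<in> space M. u < ?Y \<omega>}" for n
      proof (rule prob_ge_if_cells_imp)
        show "AE \<omega> in M. \<omega> \<in> first_arrival_cell (1 / real (Suc n)) u {..k} j
            \<longrightarrow> \<omega> \<in> {\<omega> \<in> space M. u < ?Y \<omega>}" for j
          using gap_in_first_arrival_cell(1)[of "1 / real (Suc n)" u k j] u
          by (auto elim!: eventually_mono simp: first_arrival_cell_def)
      qed (use u events in auto)
      then show "\<exists>N. \<forall>n\<ge>N. cell_weight (1 / real (Suc n)) * (1 - erlang_CDF k rate u)
          \<le> prob {\<omega> \<in> space M. u < ?Y \<omega>}"
        using measure_poisson_eq_erlang_CDF(1)[OF u] by simp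
    qed
    moreover have "prob {\<omega> \<in> space M. u < ?Y \<omega>} = 1 - prob {\<omega> \<in> space M. ?Y \<omega> \<le> u}"
      using prob_neg[OF events(2)[of u]] by (simp only: not_le)
    ultimately show "prob {\<omega> \<in> space M. ?Y \<omega> \<le> u} \<le> erlang_CDF k rate u"
      by simp
  next
    \<comment> \<open>With \<open>h = 1 / real (Suc n)\<close>, the window is shortened to
      \<open>u - h\<close> to absorb the loss of \<open>h\<close>; continuity restores
      \<open>u\<close>. The limit is first taken for the explicit formula because
      \<open>erlang_CDF\<close> has a case split at 0.\<close>
    have "(\<lambda>n. u - 1 / real (Suc n)) \<longlonglongrightarrow> u"
      by real_asymp
    then have lim: "(\<lambda>n. 1 - (\<Sum>m\<le>k. ((rate * (u - 1 / real (Suc n)))^m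
          * exp (- rate * (u - 1 / real (Suc n))) / fact m))) \<longlonglongrightarrow> erlang_CDF k rate u"
      using u by (auto simp: erlang_CDF_def intro!: tendsto_intros)
    have ev: "eventually (\<lambda>n. 1 / real (Suc n) < u) sequentially"
      using u by real_asymp
    then have "(\<lambda>n. erlang_CDF k rate (u - 1 / real (Suc n))) \<longlonglongrightarrow> erlang_CDF k rate u"
      by (intro Lim_transform_eventually[OF lim]) (auto elim!: eventually_mono simp: erlang_CDF_def)
    from tendsto_mult[OF cell_weight_tendsto_1 this]
    have "(\<lambda>n. cell_weight (1 / real (Suc n)) * erlang_CDF k rate (u - 1 / real (Suc n)))
        \<longlonglongrightarrow> erlang_CDF k rate u"
      by simp
    then show "erlang_CDF k rate u \<le> prob {\<omega> \<in> space M. ?Y \<omega> \<le> u}"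
    proof (rule tendsto_upperbound)
      show "\<forall>\<^sub>F n in sequentially. cell_weight (1 / real (Suc n))
          * erlang_CDF k rate (u - 1 / real (Suc n)) \<le> prob {\<omega> \<in> space M. ?Y \<omega> \<le> u}"
        using ev
      proof eventually_elim
        case (elim n)
        have "cell_weight (1 / real (Suc n))
            * measure (poisson_pmf (rate * (u - 1 / real (Suc n)))) {k<..}
          \<le> prob {\<omega> \<in> space M. ?Y \<omega> \<le> u}"
        proof (rule prob_ge_if_cells_imp)
          show "AE \<omega> in M. \<omega> \<in> first_arrival_cell (1 / real (Suc n)) (u - 1 / real (Suc n)) {k<..} j
              \<longrightarrow> \<omega> \<in> {\<omega> \<in> space M. ?Y \<omega> \<le> u}" for j
            using gap_in_first_arrival_cell(2)[of "1 / real (Suc n)" "u - 1 / real (Suc n)" k j] elim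
            by (auto elim!: eventually_mono simp: first_arrival_cell_def)
        qed (use elim events in auto)
        then show ?case
          using measure_poisson_eq_erlang_CDF(2)[of "u - 1 / real (Suc n)" k] elim by simp
      qed
    qed simp
  qed
  show ?thesis
  proof (subst erlang_distributed_iff[OF rate_pos], intro conjI allI impI rate_pos)
    fix u :: real assume "0 \<le> u"
    show "prob {\<omega> \<in> space M. ?Y \<omega> \<le> u} = erlang_CDF k rate u"
    proof (cases "u = 0")
      case True
      \<comment> \<open>The cell bounds require a positive window, so at 0 the probability is
        bounded by \<open>erlang_CDF k rate (1 / real (Suc n))\<close>, which tends to
        \<open>erlang_CDF k rate 0 = 0\<close>.\<close>
      have "(\<lambda>n. 1 / real (Suc n)) \<longlonglongrightarrow> 0"
        by real_asymp
      then have "(\<lambda>n. 1 - (\<Sum>m\<le>k. (rate * (1 / real (Suc n)))^m * exp (- rate * (1 / real (Suc n))) / fact m))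
          \<longlonglongrightarrow> 1 - (\<Sum>m\<le>k. (rate * 0)^m * exp (- rate * 0) / fact m)"
        by (intro tendsto_intros) auto
      also have "1 - (\<Sum>m\<le>k. (rate * 0)^m * exp (- rate * 0) / fact m) = erlang_CDF k rate 0"
        by (simp add: erlang_CDF_def)
      also have "(\<lambda>n. 1 - (\<Sum>m\<le>k. (rate * (1 / real (Suc n)))^m * exp (- rate * (1 / real (Suc n))) / fact m))
          = (\<lambda>n. erlang_CDF k rate (1 / real (Suc n)))"
        by (simp add: erlang_CDF_def)
      finally have "prob {\<omega> \<in> space M. ?Y \<omega> \<le> 0} \<le> erlang_CDF k rate 0"
      proof (rule LIMSEQ_le_const, intro exI allI impI)
        fix n :: nat
        have "prob {\<omega> \<in> space M. ?Y \<omega> \<le> 0} \<le> prob {\<omega> \<in> space M. ?Y \<omega> \<le> 1 / real (Suc n)}"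
        proof (rule finite_measure_mono)
          have "0 \<le> 1 / real (Suc n)" by simp
          then show "{\<omega> \<in> space M. ?Y \<omega> \<le> 0} \<subseteq> {\<omega> \<in> space M. ?Y \<omega> \<le> 1 / real (Suc n)}"
            by (blast intro: order_trans)
        qed (rule events)
        then show "prob {\<omega> \<in> space M. ?Y \<omega> \<le> 0} \<le> erlang_CDF k rate (1 / real (Suc n))"
          by (subst (asm) CDF) auto
      qed
      then show ?thesis
        using True by (simp add: erlang_CDF_at0 measure_le_0_iff)
    qed (use CDF \<open>0 \<le> u\<close> in auto)
  qed measurable
qed

end

section \<open>Moments of Gamma variables\<close>

text \<open>The recursion is Stein's identity \<open>E ((Z - \<kappa>) f(Z)) = E (Z f'(Z))\<close> for a Gamma variable
  \<open>Z\<close> of shape \<open>\<kappa>\<close>, applied to \<open>f(z) = (z - \<kappa>)\<^bsup>p + 1\<^esup>\<close>.\<close>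

fun gamma_central_moment :: "real \<Rightarrow> nat \<Rightarrow> real" where
  "gamma_central_moment \<kappa> 0 = 1"
| "gamma_central_moment \<kappa> (Suc 0) = 0"
| "gamma_central_moment \<kappa> (Suc (Suc p)) =
     real (Suc p) * (gamma_central_moment \<kappa> (Suc p) + \<kappa> * gamma_central_moment \<kappa> p)"

text \<open>For a Gamma variable of shape \<open>\<kappa>\<close>, this is the \<open>p\<close>-th
  moment about \<open>(1 + c) * \<kappa>\<close>, expanded binomially. The explicit form can be
  estimated without a probability space.\<close>

definition gamma_shifted_moment :: "real \<Rightarrow> nat \<Rightarrow> real \<Rightarrow> real" where
  "gamma_shifted_moment c p \<kappa>
     = (\<Sum>i\<le>p. real (p choose i) * gamma_central_moment \<kappa> i * (- c * \<kappa>) ^ (p - i))"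

text \<open>\<open>A j p\<close> stands for the expectation of
  \<open>Z ^ j * (Z - \<kappa>) ^ p\<close>, and the conclusion is Stein's identity for
  \<open>f(z) = z ^ j * (z - \<kappa>) ^ p\<close>, obtained from the raw moments by induction
  instead of integration by parts. For \<open>p = 0\<close> the truncated \<open>p - 1\<close> is
  harmless, its factor being 0.\<close>

lemma stein_recursion:
  fixes A :: "nat \<Rightarrow> nat \<Rightarrow> real"
  assumes shift: "\<And>j p. A j (Suc p) = A (Suc j) p - \<kappa> * A j p"
    and mom: "\<And>j. A (Suc j) 0 = (\<kappa> + real j) * A j 0"
  shows "A j (Suc p) = real j * A j p + real p * A (Suc j) (p - 1)"
proof (induction p arbitrary: j)
  case 0
  show ?case
    by (simp add: shift mom algebra_simps)
next
  case (Suc p)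
  have "A j (Suc (Suc p)) = A (Suc j) (Suc p) - \<kappa> * A j (Suc p)"
    by (rule shift)
  also have "\<dots> = real j * (A (Suc j) p - \<kappa> * A j p) + A (Suc j) p
      + real p * (A (Suc (Suc j)) (p - 1) - \<kappa> * A (Suc j) (p - 1))"
    unfolding Suc.IH by (simp add: algebra_simps)
  also have "\<dots> = real j * A j (Suc p) + A (Suc j) p + real p * A (Suc j) p"
    using shift[of j p] shift[of "Suc j" "p - 1"] by (cases p) (simp_all del: of_nat_Suc)
  finally show ?case
    by (simp add: algebra_simps)
qed

context prob_space
begin

text \<open>The powers \<open>Z ^ j\<close> are carried along because the recursion leaves
  \<open>j = 0\<close>: Stein's identity leads from \<open>A 0 (p + 2)\<close> to
  \<open>A 1 p\<close>, and \<open>shift\<close> leads back. The density of index \<open>k\<close>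
  has shape \<open>k + 1\<close>.\<close>

lemma erlang_central_moment:
  assumes "rate > 0" and D: "distributed M lborel Y (erlang_density k rate)"
  shows "has_bochner_integral M (\<lambda>\<omega>. (rate * Y \<omega> - real (Suc k)) ^ p)
           (gamma_central_moment (real (Suc k)) p)"
proof -
  let ?\<kappa> = "real (Suc k)"
  define Z where "Z = (\<lambda>\<omega>. rate * Y \<omega>)"
  have DZ: "distributed M lborel Z (erlang_density k 1)"
    using erlang_distributed_mult_const[OF D \<open>rate > 0\<close> \<open>rate > 0\<close>] \<open>rate > 0\<close>
    by (simp add: Z_def)
  have int: "integrable M (\<lambda>\<omega>. Z \<omega> ^ j * (Z \<omega> - ?\<kappa>) ^ p)" for j p
  proof (induction p arbitrary: j)
    case 0
    show ?case
      using erlang_ith_moment_integrable[OF _ DZ] by simp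
  next
    case (Suc p)
    have "integrable M (\<lambda>\<omega>. Z \<omega> ^ Suc j * (Z \<omega> - ?\<kappa>) ^ p - ?\<kappa> * (Z \<omega> ^ j * (Z \<omega> - ?\<kappa>) ^ p))"
      by (intro Bochner_Integration.integrable_diff integrable_mult_right Suc.IH)
    then show ?case
      by (simp add: algebra_simps)
  qed
  define A where "A = (\<lambda>j p. expectation (\<lambda>\<omega>. Z \<omega> ^ j * (Z \<omega> - ?\<kappa>) ^ p))"
  have shift: "A j (Suc p) = A (Suc j) p - ?\<kappa> * A j p" for j p
  proof -
    have "A (Suc j) p - ?\<kappa> * A j p
        = expectation (\<lambda>\<omega>. Z \<omega> ^ Suc j * (Z \<omega> - ?\<kappa>) ^ p - ?\<kappa> * (Z \<omega> ^ j * (Z \<omega> - ?\<kappa>) ^ p))"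
      unfolding A_def
      by (subst Bochner_Integration.integral_diff)
        (auto intro!: int integrable_mult_right simp del: power_Suc of_nat_Suc)
    then show ?thesis
      by (simp add: A_def algebra_simps)
  qed
  have mom: "A (Suc j) 0 = (?\<kappa> + real j) * A j 0" for j
    using erlang_ith_moment[OF _ DZ] by (simp add: A_def del: power_Suc)
  note stein = stein_recursion[of A, OF shift mom]
  have "A 0 p = gamma_central_moment ?\<kappa> p"
  proof (induction ?\<kappa> p rule: gamma_central_moment.induct)
    case 1
    show ?case by (simp add: A_def prob_space)
  next
    case 2
    show ?case by (simp add: stein)
  next
    case (3 p)
    have "A 0 (Suc (Suc p)) = real (Suc p) * A 1 p"
      by (simp add: stein)
    also have "A 1 p = A 0 (Suc p) + ?\<kappa> * A 0 p"
      by (simp add: shift)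
    finally show ?case
      using 3 by simp
  qed
  then show ?thesis
    using int[of 0 p] by (simp add: has_bochner_integral_iff A_def Z_def)
qed

text \<open>After scaling by \<open>rate\<close> the centre differs from the mean
  \<open>\<kappa>\<close> by \<open>c * \<kappa>\<close>, so the binomial theorem reduces the claim
  to central moments.\<close>

lemma erlang_shifted_moment:
  assumes "rate > 0" and D: "distributed M lborel Y (erlang_density k rate)"
  shows "has_bochner_integral M (\<lambda>\<omega>. (Y \<omega> - real (Suc k) * ((1 + c) / rate)) ^ p)
     (gamma_shifted_moment c p (real (Suc k)) / rate ^ p)"
proof -
  let ?\<kappa> = "real (Suc k)"
  have "has_bochner_integral M
      (\<lambda>\<omega>. (\<Sum>i\<le>p. (rate * Y \<omega> - ?\<kappa>) ^ i * (real (p choose i) * (- c * ?\<kappa>) ^ (p - i))) / rate ^ p)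
      ((\<Sum>i\<le>p. gamma_central_moment ?\<kappa> i * (real (p choose i) * (- c * ?\<kappa>) ^ (p - i))) / rate ^ p)"
    by (intro has_bochner_integral_divide_zero has_bochner_integral_sum has_bochner_integral_mult_left
        erlang_central_moment assms)
  moreover have "(\<Sum>i\<le>p. (rate * Y \<omega> - ?\<kappa>) ^ i * (real (p choose i) * (- c * ?\<kappa>) ^ (p - i))) / rate ^ p
      = (Y \<omega> - ?\<kappa> * ((1 + c) / rate)) ^ p" for \<omega>
  proof -
    have "Y \<omega> - ?\<kappa> * ((1 + c) / rate) = ((rate * Y \<omega> - ?\<kappa>) + (- c * ?\<kappa>)) / rate"
      using \<open>rate > 0\<close> by (simp add: field_simps)
    then show ?thesis
      by (simp only: power_divide binomial_ring) (simp add: mult_ac)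
  qed
  ultimately show ?thesis
    by (simp add: mult_ac gamma_shifted_moment_def)
qed

text \<open>Jensen's inequality for an even power. The mean of \<open>W\<close> is
  \<open>- c * real (Suc k) / rate\<close> because the first central moment vanishes; the even
  exponent removes the sign.\<close>

lemma gamma_shifted_moment_ge:
  assumes "rate > 0" and D: "distributed M lborel Y (erlang_density k rate)" and "even p"
  shows "(c * real (Suc k)) ^ p \<le> gamma_shifted_moment c p (real (Suc k))"
proof -
  define W where "W = (\<lambda>\<omega>. Y \<omega> - real (Suc k) * ((1 + c) / rate))"
  have W: "has_bochner_integral M (\<lambda>\<omega>. W \<omega> ^ i) (gamma_shifted_moment c i (real (Suc k)) / rate ^ i)" for i
    unfolding W_def by (rule erlang_shifted_moment[OF assms(1,2)])
  have "expectation W ^ p \<le> expectation (\<lambda>\<omega>. W \<omega> ^ p)"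
    using W[of 1] W[of p] \<open>even p\<close>
    by (intro jensens_inequality[where I = UNIV]) (auto simp: has_bochner_integral_iff convex_power_even)
  also have "\<dots> = gamma_shifted_moment c p (real (Suc k)) / rate ^ p"
    using W[of p] by (simp add: has_bochner_integral_iff)
  also have "expectation W = - (c * real (Suc k)) / rate"
    using W[of 1] by (simp add: has_bochner_integral_iff gamma_shifted_moment_def)
  finally show ?thesis
    using \<open>even p\<close> \<open>rate > 0\<close> by (simp add: power_divide divide_le_cancel del: of_nat_Suc)
qed

end

section \<open>Growth of the moments in the shape parameter\<close>

text \<open>The exponent \<open>p\<close> is not sharp in general, but it suffices for shifted
  moments: there the central moment of order \<open>i\<close> comes with the factor
  \<open>(- c * \<kappa>) ^ (p - i)\<close>.\<close>

lemma gamma_central_moment_bound: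
  "\<exists>C\<ge>0. \<forall>\<kappa>\<ge>1. \<bar>gamma_central_moment \<kappa> p\<bar> \<le> C * \<kappa> ^ p"
proof (induction p rule: induct_nat_012)
  case 0
  show ?case by (intro exI[of _ 1]) auto
next
  case 1
  show ?case by (intro exI[of _ 1]) auto
next
  case (ge2 p)
  then obtain C D where CD: "C \<ge> 0" "D \<ge> 0"
    "\<And>\<kappa>. \<kappa> \<ge> 1 \<Longrightarrow> \<bar>gamma_central_moment \<kappa> p\<bar> \<le> C * \<kappa> ^ p"
    "\<And>\<kappa>. \<kappa> \<ge> 1 \<Longrightarrow> \<bar>gamma_central_moment \<kappa> (Suc p)\<bar> \<le> D * \<kappa> ^ Suc p"
    by blast
  show ?case
  proof (intro exI[of _ "real (Suc p) * (C + D)"] conjI allI impI)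
    fix \<kappa> :: real assume \<kappa>: "\<kappa> \<ge> 1"
    have "\<bar>gamma_central_moment \<kappa> (Suc p) + \<kappa> * gamma_central_moment \<kappa> p\<bar>
        \<le> D * \<kappa> ^ Suc p + \<kappa> * (C * \<kappa> ^ p)"
      using CD(3,4)[OF \<kappa>] \<kappa>
      by (intro order_trans[OF abs_triangle_ineq] add_mono) (auto simp: abs_mult mult_left_mono)
    also have "\<dots> = (C + D) * \<kappa> ^ Suc p"
      by (simp add: algebra_simps)
    also have "\<dots> \<le> (C + D) * \<kappa> ^ Suc (Suc p)"
      using CD \<kappa> by (intro mult_left_mono power_increasing) auto
    finally show "\<bar>gamma_central_moment \<kappa> (Suc (Suc p))\<bar> \<le> real (Suc p) * (C + D) * \<kappa> ^ Suc (Suc p)"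
      by (simp only: gamma_central_moment.simps abs_mult abs_of_nat mult.assoc)
        (rule mult_left_mono, auto)
  qed (use CD in auto)
qed

text \<open>The first bound is multiplied by \<open>\<kappa>\<close> because for \<open>q = 0\<close> the error exponent \<open>q - 1\<close>
  would be truncated.\<close>

lemma gamma_central_moment_asymp:
  "\<exists>C\<ge>0. \<forall>\<kappa>\<ge>1.
     \<bar>\<kappa> * gamma_central_moment \<kappa> (2 * q) - fact (2 * q) / (2 ^ q * fact q) * \<kappa> ^ Suc q\<bar> \<le> C * \<kappa> ^ q
     \<and> \<bar>gamma_central_moment \<kappa> (Suc (2 * q))\<bar> \<le> C * \<kappa> ^ q"
proof (induction q)
  case 0
  show ?case by (intro exI[of _ 1]) auto
next
  case (Suc q)
  \<comment> \<open>\<open>d q\<close> is the double factorial \<open>(2q - 1)!!\<close>; the ratio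
    \<open>2q + 1\<close> of consecutive values is the factor in the recursion for even
    orders.\<close>
  define d where "d = (\<lambda>q. fact (2 * q) / (2 ^ q * fact q) :: real)"
  have d: "d (Suc q) = (2 * real q + 1) * d q"
  proof -
    have "d (Suc q) = (2 * (real q + 1)) * ((2 * real q + 1) * fact (2 * q))
        / ((2 * (real q + 1)) * (2 ^ q * fact q))"
      by (simp add: d_def algebra_simps)
    then show ?thesis
      by (subst (asm) mult_divide_mult_cancel_left) (auto simp: d_def)
  qed
  define m where "m = gamma_central_moment"
  from Suc obtain C where C: "C \<ge> 0"
    "\<And>\<kappa>. \<kappa> \<ge> 1 \<Longrightarrow> \<bar>\<kappa> * m \<kappa> (2 * q) - d q * \<kappa> ^ Suc q\<bar> \<le> C * \<kappa> ^ q"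
    "\<And>\<kappa>. \<kappa> \<ge> 1 \<Longrightarrow> \<bar>m \<kappa> (Suc (2 * q))\<bar> \<le> C * \<kappa> ^ q"
    unfolding d_def m_def by blast
  have d0: "d q \<ge> 0"
    by (simp add: d_def)
  \<comment> \<open>\<open>B\<close> bounds the moment of order \<open>2 * Suc q\<close> relative to
    \<open>\<kappa> ^ Suc q\<close>. \<open>K\<close> results from feeding \<open>B\<close> into the
    odd step, and also covers the even error.\<close>
  define B where "B = (2 * real q + 1) * (2 * C + d q) "
  have B0: "B \<ge> 0" "B \<ge> (2 * real q + 1) * (2 * C)"
    using C(1) d0 by (auto simp: B_def intro!: mult_left_mono)
  define K where "K = (2 * real q + 2) * (B + C)"
  have "B + C \<le> K"
    using B0 C(1) mult_right_mono[of 1 "2 * real q + 2" "B + C"] by (simp add: K_def)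
  then have K: "K \<ge> 0" "B \<le> K"
    using B0 C(1) by auto
  have even: "m \<kappa> (2 * Suc q) = (2 * real q + 1) * (m \<kappa> (Suc (2 * q)) + \<kappa> * m \<kappa> (2 * q))" for \<kappa>
    by (simp add: m_def)
  have odd: "m \<kappa> (Suc (2 * Suc q)) = (2 * real q + 2) * (m \<kappa> (2 * Suc q) + \<kappa> * m \<kappa> (Suc (2 * q)))" for \<kappa>
    by (simp add: m_def)
  have "\<bar>\<kappa> * m \<kappa> (2 * Suc q) - d (Suc q) * \<kappa> ^ Suc (Suc q)\<bar> \<le> K * \<kappa> ^ Suc q
     \<and> \<bar>m \<kappa> (Suc (2 * Suc q))\<bar> \<le> K * \<kappa> ^ Suc q" if \<kappa>: "\<kappa> \<ge> 1" for \<kappa>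
  proof -
    have pow: "\<kappa> ^ q \<le> \<kappa> ^ Suc q" "0 \<le> \<kappa> ^ q"
      using \<kappa> by (auto intro: power_increasing)
    \<comment> \<open>What remains beside the main term \<open>d q * \<kappa> ^ Suc q\<close>.
      Bounding it takes the hypotheses for both parities, hence the joint induction.\<close>
    let ?r = "m \<kappa> (Suc (2 * q)) + (\<kappa> * m \<kappa> (2 * q) - d q * \<kappa> ^ Suc q)"
    have r: "\<bar>?r\<bar> \<le> 2 * C * \<kappa> ^ q"
      using C(2,3)[OF \<kappa>] by linarith
    have e: "m \<kappa> (2 * Suc q) = (2 * real q + 1) * (?r + d q * \<kappa> ^ Suc q)"
      unfolding even by simp
    have "\<kappa> * m \<kappa> (2 * Suc q) - d (Suc q) * \<kappa> ^ Suc (Suc q) = (2 * real q + 1) * (\<kappa> * ?r)"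
      unfolding e d by (simp add: algebra_simps)
    then have "\<bar>\<kappa> * m \<kappa> (2 * Suc q) - d (Suc q) * \<kappa> ^ Suc (Suc q)\<bar> = (2 * real q + 1) * (\<kappa> * \<bar>?r\<bar>)"
      using \<kappa> by (simp add: abs_mult)
    also have "\<dots> \<le> (2 * real q + 1) * (\<kappa> * (2 * C * \<kappa> ^ q))"
      using r \<kappa> by (intro mult_left_mono) auto
    also have "\<dots> = (2 * real q + 1) * (2 * C) * \<kappa> ^ Suc q"
      by simp
    also have "\<dots> \<le> K * \<kappa> ^ Suc q"
      using K(2) B0(2) pow by (intro mult_right_mono) auto
    finally have 1: "\<bar>\<kappa> * m \<kappa> (2 * Suc q) - d (Suc q) * \<kappa> ^ Suc (Suc q)\<bar> \<le> K * \<kappa> ^ Suc q" .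
    have "\<bar>?r + d q * \<kappa> ^ Suc q\<bar> \<le> 2 * C * \<kappa> ^ q + d q * \<kappa> ^ Suc q"
    proof -
      have "0 \<le> d q * \<kappa> ^ Suc q"
        using d0 \<kappa> by simp
      with r show ?thesis by linarith
    qed
    also have "\<dots> \<le> (2 * C + d q) * \<kappa> ^ Suc q"
      using mult_left_mono[OF pow(1), of "2 * C"] C(1) by (simp add: distrib_right)
    finally have "\<bar>m \<kappa> (2 * Suc q)\<bar> \<le> B * \<kappa> ^ Suc q"
      unfolding e B_def abs_mult mult.assoc by (intro mult_mono) auto
    moreover have "\<bar>\<kappa> * m \<kappa> (Suc (2 * q))\<bar> \<le> C * \<kappa> ^ Suc q"
      using mult_left_mono[OF C(3)[OF \<kappa>], of \<kappa>] \<kappa> by (simp add: abs_mult mult_ac)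
    ultimately have "\<bar>m \<kappa> (2 * Suc q) + \<kappa> * m \<kappa> (Suc (2 * q))\<bar> \<le> (B + C) * \<kappa> ^ Suc q"
      by (simp add: distrib_right)
    then have 2: "\<bar>m \<kappa> (Suc (2 * Suc q))\<bar> \<le> K * \<kappa> ^ Suc q"
      unfolding odd K_def abs_mult mult.assoc by (intro mult_mono) auto
    from 1 2 show ?thesis by blast
  qed
  then show ?case
    using K(1) unfolding m_def d_def by blast
qed

lemma gamma_central_moment_even:
  assumes "h > 0"
  shows "\<exists>C\<ge>0. \<forall>\<kappa>\<ge>1.
    \<bar>gamma_central_moment \<kappa> (2 * h) - fact (2 * h) / (2 ^ h * fact h) * \<kappa> ^ h\<bar> \<le> C * \<kappa> ^ (h - 1)"
proof -
  define d :: real where "d = fact (2 * h) / (2 ^ h * fact h)"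
  obtain C where C: "C \<ge> 0" "\<And>\<kappa>. \<kappa> \<ge> 1 \<Longrightarrow>
      \<bar>\<kappa> * gamma_central_moment \<kappa> (2 * h) - d * \<kappa> ^ Suc h\<bar> \<le> C * \<kappa> ^ h"
    using gamma_central_moment_asymp[of h] unfolding d_def by blast
  have "\<bar>gamma_central_moment \<kappa> (2 * h) - d * \<kappa> ^ h\<bar> \<le> C * \<kappa> ^ (h - 1)" if "\<kappa> \<ge> 1" for \<kappa>
  proof -
    have "\<kappa> * \<bar>gamma_central_moment \<kappa> (2 * h) - d * \<kappa> ^ h\<bar>
        = \<bar>\<kappa> * (gamma_central_moment \<kappa> (2 * h) - d * \<kappa> ^ h)\<bar>"
      using that by (simp add: abs_mult)
    also have "\<dots> \<le> C * \<kappa> ^ h"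
      using C(2)[OF that] by (simp add: algebra_simps)
    also have "\<dots> = \<kappa> * (C * \<kappa> ^ (h - 1))"
      using \<open>h > 0\<close> by (cases h) auto
    finally show ?thesis
      using that by simp
  qed
  with C(1) show ?thesis
    unfolding d_def by blast
qed

lemma gamma_shifted_moment_0: "gamma_shifted_moment 0 p \<kappa> = gamma_central_moment \<kappa> p"
proof -
  have "gamma_shifted_moment 0 p \<kappa> = (\<Sum>i\<in>{p}. gamma_central_moment \<kappa> i)"
    unfolding gamma_shifted_moment_def by (rule sum.mono_neutral_cong_right) auto
  then show ?thesis by simp
qed

lemma gamma_shifted_moment_bound:
  "\<exists>C\<ge>0. \<forall>\<kappa>\<ge>1. \<bar>gamma_shifted_moment c p \<kappa>\<bar> \<le> C * \<kappa> ^ p"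
proof -
  obtain C where C: "\<And>i. C i \<ge> 0"
    "\<And>i \<kappa>. \<kappa> \<ge> 1 \<Longrightarrow> \<bar>gamma_central_moment \<kappa> i\<bar> \<le> C i * \<kappa> ^ i"
    using gamma_central_moment_bound by metis
  show ?thesis
  proof (intro exI[of _ "\<Sum>i\<le>p. real (p choose i) * C i * \<bar>c\<bar> ^ (p - i)"] conjI allI impI)
    show "0 \<le> (\<Sum>i\<le>p. real (p choose i) * C i * \<bar>c\<bar> ^ (p - i))"
      using C(1) by (intro sum_nonneg) auto
  next
    fix \<kappa> :: real assume \<kappa>: "\<kappa> \<ge> 1"
    have "\<bar>real (p choose i) * gamma_central_moment \<kappa> i * (- c * \<kappa>) ^ (p - i)\<bar>
        \<le> real (p choose i) * C i * \<bar>c\<bar> ^ (p - i) * \<kappa> ^ p" if "i \<le> p" for i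
    proof -
      have "\<bar>real (p choose i) * gamma_central_moment \<kappa> i * (- c * \<kappa>) ^ (p - i)\<bar>
          = real (p choose i) * \<bar>c\<bar> ^ (p - i) * (\<bar>gamma_central_moment \<kappa> i\<bar> * \<kappa> ^ (p - i))"
        using \<kappa> by (simp add: abs_mult power_abs power_mult_distrib)
      also have "\<dots> \<le> real (p choose i) * \<bar>c\<bar> ^ (p - i) * ((C i * \<kappa> ^ i) * \<kappa> ^ (p - i))"
        using C(2)[OF \<kappa>] \<kappa> by (intro mult_left_mono mult_right_mono) auto
      also have "\<dots> = real (p choose i) * C i * \<bar>c\<bar> ^ (p - i) * (\<kappa> ^ i * \<kappa> ^ (p - i))"
        by simp
      also have "\<kappa> ^ i * \<kappa> ^ (p - i) = \<kappa> ^ p"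
        using that by (simp flip: power_add)
      finally show ?thesis .
    qed
    then show "\<bar>gamma_shifted_moment c p \<kappa>\<bar>
        \<le> (\<Sum>i\<le>p. real (p choose i) * C i * \<bar>c\<bar> ^ (p - i)) * \<kappa> ^ p"
      unfolding gamma_shifted_moment_def sum_distrib_right
      by (intro order_trans[OF sum_abs] sum_mono) auto
  qed
qed

section \<open>Sums of powers\<close>

text \<open>\<open>(k + 1) ^ (h + 1) - k ^ (h + 1)\<close> is a sum of \<open>h + 1\<close>
  products, each between \<open>k ^ h\<close> and \<open>(k + 1) ^ h\<close>; summing over
  \<open>k\<close> telescopes.\<close>

lemma sum_powers_bounds:
  "real n ^ Suc h / real (Suc h) - real n ^ h \<le> (\<Sum>k<n. real k ^ h)"
  "(\<Sum>k<n. real k ^ h) \<le> real n ^ Suc h / real (Suc h)"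
proof -
  have step: "real (Suc h) * real k ^ h \<le> real (Suc k) ^ Suc h - real k ^ Suc h"
    "real (Suc k) ^ Suc h - real k ^ Suc h \<le> real (Suc h) * real (Suc k) ^ h" for k
  proof -
    have eq: "real (Suc k) ^ Suc h - real k ^ Suc h = (\<Sum>p<Suc h. real (Suc k) ^ p * real k ^ (h - p))"
      by (subst power_diff_sumr2) (simp add: mult.commute)
    have "real k ^ h \<le> real (Suc k) ^ p * real k ^ (h - p)" if "p < Suc h" for p
    proof -
      have "real k ^ h = real k ^ p * real k ^ (h - p)"
        using that by (simp flip: power_add)
      also have "\<dots> \<le> real (Suc k) ^ p * real k ^ (h - p)"
        by (intro mult_right_mono power_mono) auto
      finally show ?thesis .
    qed
    then have "(\<Sum>p<Suc h. real k ^ h) \<le> (\<Sum>p<Suc h. real (Suc k) ^ p * real k ^ (h - p))"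
      by (intro sum_mono) auto
    then show "real (Suc h) * real k ^ h \<le> real (Suc k) ^ Suc h - real k ^ Suc h"
      unfolding eq by simp
    have "real (Suc k) ^ p * real k ^ (h - p) \<le> real (Suc k) ^ h" if "p < Suc h" for p
    proof -
      have "real (Suc k) ^ p * real k ^ (h - p) \<le> real (Suc k) ^ p * real (Suc k) ^ (h - p)"
        by (intro mult_left_mono power_mono) auto
      also have "\<dots> = real (Suc k) ^ h"
        using that by (simp flip: power_add)
      finally show ?thesis .
    qed
    then have "(\<Sum>p<Suc h. real (Suc k) ^ p * real k ^ (h - p)) \<le> (\<Sum>p<Suc h. real (Suc k) ^ h)"
      by (intro sum_mono) auto
    then show "real (Suc k) ^ Suc h - real k ^ Suc h \<le> real (Suc h) * real (Suc k) ^ h"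
      unfolding eq by simp
  qed
  have tele: "(\<Sum>k<n. real (Suc k) ^ Suc h - real k ^ Suc h) = real n ^ Suc h"
    by (subst sum_lessThan_telescope) simp
  have "real (Suc h) * (\<Sum>k<n. real k ^ h) \<le> real n ^ Suc h"
    unfolding tele[symmetric] sum_distrib_left by (intro sum_mono step)
  then show "(\<Sum>k<n. real k ^ h) \<le> real n ^ Suc h / real (Suc h)"
    by (simp add: field_simps)
  have "real n ^ Suc h \<le> real (Suc h) * (\<Sum>k<n. real (Suc k) ^ h)"
    unfolding tele[symmetric] sum_distrib_left by (intro sum_mono step)
  \<comment> \<open>Shifting the index by one costs \<open>real n ^ h\<close>. The boundary term
    \<open>real 0 ^ h\<close> is 1 for \<open>h = 0\<close>, so only its sign is used.\<close>
  also have "\<dots> \<le> real (Suc h) * ((\<Sum>k<n. real k ^ h) + real n ^ h)"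
  proof (rule mult_left_mono)
    have "(\<Sum>k<n. real (Suc k) ^ h) - (\<Sum>k<n. real k ^ h) = real n ^ h - real 0 ^ h"
      unfolding sum_subtractf[symmetric] by (rule sum_lessThan_telescope)
    moreover have "0 \<le> real 0 ^ h"
      by simp
    ultimately show "(\<Sum>k<n. real (Suc k) ^ h) \<le> (\<Sum>k<n. real k ^ h) + real n ^ h"
      by linarith
  qed simp
  finally show "real n ^ Suc h / real (Suc h) - real n ^ h \<le> (\<Sum>k<n. real k ^ h)"
    by (simp add: field_simps)
qed

section \<open>The expected movement as a sum of moments\<close>

context poisson_arrivals
begin

text \<open>As \<open>a\<close> is even the absolute values disappear. The gap of sensor
  \<open>i\<close> has shape \<open>i - 1\<close>, so the shapes 1 to \<open>n - 1\<close>
  occur.\<close>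

lemma expected_mv1_movement:
  assumes "even a" "a > 0"
  shows "expectation (\<lambda>\<omega>. total_movement a n (\<lambda>i. X i \<omega>) (mv1 ((1 + c) / rate) (\<lambda>i. X i \<omega>)))
       = (\<Sum>k=1..<n. gamma_shifted_moment c a (real k)) / rate ^ a"
proof -
  let ?g = "\<lambda>\<omega> i. (X i \<omega> - X 1 \<omega> - (real i - 1) * ((1 + c) / rate)) ^ a"
  have moment: "has_bochner_integral M (\<lambda>\<omega>. ?g \<omega> i) (gamma_shifted_moment c a (real (i - 1)) / rate ^ a)"
    if "i \<in> {2..n}" for i
  proof -
    define k where "k = i - 2"
    have i: "i = k + 2"
      using that by (auto simp: k_def)
    have "real i - 1 = real (Suc k)" "i - 1 = Suc k"
      by (simp_all add: i)
    then show ?thesis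
      using erlang_shifted_moment[OF rate_pos erlang_gap, of k c a] by (simp only: i)
  qed
  have "total_movement a n (\<lambda>i. X i \<omega>) (mv1 ((1 + c) / rate) (\<lambda>i. X i \<omega>)) = (\<Sum>i=2..n. ?g \<omega> i)" for \<omega>
    using assms by (simp add: total_movement_mv1 power_even_abs)
  then have "expectation (\<lambda>\<omega>. total_movement a n (\<lambda>i. X i \<omega>) (mv1 ((1 + c) / rate) (\<lambda>i. X i \<omega>)))
      = expectation (\<lambda>\<omega>. \<Sum>i=2..n. ?g \<omega> i)"
    by simp
  also have "\<dots> = (\<Sum>i=2..n. gamma_shifted_moment c a (real (i - 1)) / rate ^ a)"
    by (intro has_bochner_integral_integral_eq has_bochner_integral_sum moment)
  also have "\<dots> = (\<Sum>k=1..<n. gamma_shifted_moment c a (real k) / rate ^ a)"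
    by (rule sum.reindex_bij_witness[of _ Suc "\<lambda>i. i - 1"]) auto
  finally show ?thesis
    by (simp add: sum_divide_distrib)
qed

end

section \<open>Asymptotics in the number of sensors\<close>

lemma sum_powers_from_1: "h > 0 \<Longrightarrow> (\<Sum>k=1..<n. real k ^ h) = (\<Sum>k<n. real k ^ h)"
  by (rule sum.mono_neutral_left) auto

text \<open>Summing the leading terms contributes \<open>1 / (h + 1)\<close>, which turns
  \<open>fact h\<close> into \<open>fact (h + 1)\<close>. The termwise errors add up to at most
  \<open>C * n ^ h\<close>, and evaluating the power sum costs \<open>d * n ^ h\<close>.\<close>

lemma sum_gamma_central_moment:
  assumes "h > 0"
  shows "\<exists>C. \<forall>n. \<bar>(\<Sum>k=1..<n. gamma_central_moment (real k) (2 * h))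
    - fact (2 * h) / (2 ^ h * fact (h + 1)) * real n ^ Suc h\<bar> \<le> C * real n ^ h"
proof -
  define d :: real where "d = fact (2 * h) / (2 ^ h * fact h)"
  obtain C where C: "C \<ge> 0" "\<And>\<kappa>. \<kappa> \<ge> 1 \<Longrightarrow>
      \<bar>gamma_central_moment \<kappa> (2 * h) - d * \<kappa> ^ h\<bar> \<le> C * \<kappa> ^ (h - 1)"
    using gamma_central_moment_even[OF assms] unfolding d_def by blast
  have d0: "d \<ge> 0"
    by (simp add: d_def)
  have d: "fact (2 * h) / (2 ^ h * fact (h + 1)) * real n ^ Suc h = d * (real n ^ Suc h / real (Suc h))" for n
    by (simp add: d_def)
  have "\<bar>(\<Sum>k=1..<n. gamma_central_moment (real k) (2 * h)) - d * (real n ^ Suc h / real (Suc h))\<bar>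
      \<le> (C + d) * real n ^ h" for n
  proof -
    have "\<bar>(\<Sum>k=1..<n. gamma_central_moment (real k) (2 * h)) - d * (\<Sum>k<n. real k ^ h)\<bar>
        = \<bar>\<Sum>k=1..<n. gamma_central_moment (real k) (2 * h) - d * real k ^ h\<bar>"
      using assms by (simp add: sum_subtractf sum_distrib_left flip: sum_powers_from_1)
    also have "\<dots> \<le> (\<Sum>k=1..<n. C * real n ^ (h - 1))"
    proof (rule order_trans[OF sum_abs sum_mono])
      fix k assume k: "k \<in> {1..<n}"
      have "\<bar>gamma_central_moment (real k) (2 * h) - d * real k ^ h\<bar> \<le> C * real k ^ (h - 1)"
        using k by (intro C(2)) auto
      also have "\<dots> \<le> C * real n ^ (h - 1)"
        using k C(1) by (intro mult_left_mono power_mono) auto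
      finally show "\<bar>gamma_central_moment (real k) (2 * h) - d * real k ^ h\<bar> \<le> C * real n ^ (h - 1)" .
    qed
    also have "\<dots> = real (n - 1) * (C * real n ^ (h - 1))"
      by simp
    also have "\<dots> \<le> real n * (C * real n ^ (h - 1))"
      using C(1) by (intro mult_right_mono) auto
    also have "\<dots> = C * real n ^ h"
      using assms by (cases h) auto
    finally have 1: "\<bar>(\<Sum>k=1..<n. gamma_central_moment (real k) (2 * h)) - d * (\<Sum>k<n. real k ^ h)\<bar>
        \<le> C * real n ^ h" .
    have "\<bar>d * (\<Sum>k<n. real k ^ h) - d * (real n ^ Suc h / real (Suc h))\<bar>
        = d * \<bar>(\<Sum>k<n. real k ^ h) - real n ^ Suc h / real (Suc h)\<bar>"
      using d0 by (simp only: right_diff_distrib[symmetric] abs_mult abs_of_nonneg)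
    also have "\<dots> \<le> d * real n ^ h"
    proof (rule mult_left_mono[OF _ d0])
      show "\<bar>(\<Sum>k<n. real k ^ h) - real n ^ Suc h / real (Suc h)\<bar> \<le> real n ^ h"
        using sum_powers_bounds(1)[of n h] sum_powers_bounds(2)[of h n] zero_le_power[of "real n" h]
        by linarith
    qed
    finally show ?thesis
      using 1 by (simp add: distrib_right del: of_nat_Suc power_Suc)
  qed
  then show ?thesis
    unfolding d by blast
qed

theorem theorem1:
  fixes a :: nat and \<epsilon>\<^sub>1 :: real
    and M :: "nat \<Rightarrow> 'w measure" and X :: "nat \<Rightarrow> nat \<Rightarrow> 'w \<Rightarrow> real"
    and E :: "nat \<Rightarrow> real"
  assumes "even a" and "a > 0" and "\<epsilon>\<^sub>1 \<ge> 0"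
    and "\<And>n. n \<ge> 1 \<Longrightarrow> poisson_arrivals (M n) (real n) (X n)"
    and "\<And>n. n \<ge> 1 \<Longrightarrow> E n = prob_space.expectation (M n)
           (\<lambda>\<omega>. total_movement a n (\<lambda>i. X n i \<omega>) (mv1 ((1 + \<epsilon>\<^sub>1) / real n) (\<lambda>i. X n i \<omega>)))"
  shows "(\<epsilon>\<^sub>1 = 0 \<longrightarrow>
            (\<lambda>n. E n - fact a / (2 ^ (a div 2) * fact (a div 2 + 1)) * real n powr (1 - real a / 2))
              \<in> O(\<lambda>n. real n powr (- (real a / 2))))
       \<and> (\<epsilon>\<^sub>1 > 0 \<longrightarrow> E \<in> \<Theta>(\<lambda>n. real n))"
proof (intro conjI impI)
  have E: "E n = (\<Sum>k=1..<n. gamma_shifted_moment \<epsilon>\<^sub>1 a (real k)) / real n ^ a" if "n \<ge> 1" for n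
  proof -
    interpret poisson_arrivals "M n" "real n" "X n"
      using that by (rule assms(4))
    show ?thesis
      unfolding assms(5)[OF that] using assms(1,2) by (rule expected_mv1_movement)
  qed
  {
    assume "\<epsilon>\<^sub>1 = 0"
    define h where "h = a div 2"
    have a: "a = 2 * h" and "h > 0"
      using assms(1,2) by (auto simp: h_def)
    define d :: real where "d = fact (2 * h) / (2 ^ h * fact (h + 1))"
    obtain C where C: "\<And>n. \<bar>(\<Sum>k=1..<n. gamma_central_moment (real k) (2 * h)) - d * real n ^ Suc h\<bar>
        \<le> C * real n ^ h"
      using sum_gamma_central_moment[OF \<open>h > 0\<close>] unfolding d_def by blast
    have "(\<lambda>n. E n - d * real n powr (1 - real a / 2)) \<in> O(\<lambda>n. real n powr (- (real a / 2)))"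
    proof (rule bigoI[of _ C], rule eventually_sequentiallyI[of 1])
      fix n :: nat assume n: "n \<ge> 1"
      \<comment> \<open>With \<open>a = 2 * h\<close> the exponent is \<open>(h + 1) - a\<close>,
        matching the leading power of the sum of moments after the scaling by
        \<open>real n ^ a\<close>.\<close>
      have p1: "real n powr (1 - real a / 2) = real n ^ Suc h / real n ^ a"
      proof -
        have "1 - real a / 2 = real (Suc h) - real a"
          by (simp add: a)
        then show ?thesis
          using n by (simp only: powr_diff) (simp add: powr_realpow del: of_nat_Suc)
      qed
      have p2: "real n powr (- (real a / 2)) = real n ^ h / real n ^ a"
      proof -
        have "- (real a / 2) = real h - real a"
          by (simp add: a)
        then show ?thesis
          using n by (simp only: powr_diff) (simp add: powr_realpow)
      qed
      have "E n - d * real n powr (1 - real a / 2)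
          = ((\<Sum>k=1..<n. gamma_central_moment (real k) (2 * h)) - d * real n ^ Suc h) / real n ^ a"
        unfolding E[OF n] p1 \<open>\<epsilon>\<^sub>1 = 0\<close> gamma_shifted_moment_0 by (simp add: a diff_divide_distrib)
      also have "\<bar>\<dots>\<bar> \<le> C * real n ^ h / real n ^ a"
        using C[of n] by (simp add: divide_right_mono del: power_Suc)
      finally show "norm (E n - d * real n powr (1 - real a / 2)) \<le> C * norm (real n powr (- (real a / 2)))"
        by (simp add: p2)
    qed
    then show "(\<lambda>n. E n - fact a / (2 ^ (a div 2) * fact (a div 2 + 1)) * real n powr (1 - real a / 2))
        \<in> O(\<lambda>n. real n powr (- (real a / 2)))"
      by (simp only: d_def h_def[symmetric] a[symmetric])
  }
  {
    assume pos: "\<epsilon>\<^sub>1 > 0"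
    show "E \<in> \<Theta>(\<lambda>n. real n)"
    proof (rule bigthetaI)
      obtain C where C: "C \<ge> 0" "\<And>\<kappa>. \<kappa> \<ge> 1 \<Longrightarrow> \<bar>gamma_shifted_moment \<epsilon>\<^sub>1 a \<kappa>\<bar> \<le> C * \<kappa> ^ a"
        using gamma_shifted_moment_bound by blast
      show "E \<in> O(\<lambda>n. real n)"
      proof (rule bigoI[of _ C], rule eventually_sequentiallyI[of 1])
        fix n :: nat assume n: "n \<ge> 1"
        \<comment> \<open>Each of the fewer than \<open>n\<close> summands is at most
          \<open>C * real n ^ a\<close>, and the scaling cancels this power.\<close>
        have "\<bar>\<Sum>k=1..<n. gamma_shifted_moment \<epsilon>\<^sub>1 a (real k)\<bar> \<le> (\<Sum>k=1..<n. C * real n ^ a)"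
        proof (rule order_trans[OF sum_abs sum_mono])
          fix k assume k: "k \<in> {1..<n}"
          have "\<bar>gamma_shifted_moment \<epsilon>\<^sub>1 a (real k)\<bar> \<le> C * real k ^ a"
            using k by (intro C(2)) auto
          also have "\<dots> \<le> C * real n ^ a"
            using k C(1) by (intro mult_left_mono power_mono) auto
          finally show "\<bar>gamma_shifted_moment \<epsilon>\<^sub>1 a (real k)\<bar> \<le> C * real n ^ a" .
        qed
        also have "\<dots> = real (n - 1) * (C * real n ^ a)"
          by simp
        also have "\<dots> \<le> real n * (C * real n ^ a)"
          using C(1) by (intro mult_right_mono) auto
        finally show "norm (E n) \<le> C * norm (real n)"
          using n by (simp add: E divide_le_eq mult_ac)
      qed
      show "E \<in> \<Omega>(\<lambda>n. real n)"
      \<comment> \<open>The power sum is at least \<open>n ^ (a + 1) / (a + 1) - n ^ a\<close>. From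
        \<open>n = 2 * (a + 1)\<close> on, the subtracted term is at most half of the first; this
        gives the threshold and the 2 in the constant.\<close>
      proof (rule landau_omega.bigI[of "\<epsilon>\<^sub>1 ^ a / (2 * real (Suc a))"],
          use pos in simp, rule eventually_sequentiallyI[of "2 * Suc a"])
        fix n :: nat assume n': "2 * Suc a \<le> n"
        then have n: "n \<ge> 1"
          by simp
        interpret poisson_arrivals "M n" "real n" "X n"
          using n by (rule assms(4))
        \<comment> \<open>Shape \<open>k\<close> belongs to the Erlang index \<open>k - 1\<close>,
          that is, to the gap from \<open>X n 1\<close> to \<open>X n (k + 1)\<close>.\<close>
        have lower: "(\<epsilon>\<^sub>1 * real k) ^ a \<le> gamma_shifted_moment \<epsilon>\<^sub>1 a (real k)" if "k \<in> {1..<n}" for k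
          using gamma_shifted_moment_ge[OF rate_pos erlang_gap \<open>even a\<close>, of \<epsilon>\<^sub>1 "k - 1"] that by simp
        have half: "real n / (2 * real (Suc a)) \<le> real n / real (Suc a) - 1"
        proof -
          have "real (2 * Suc a) \<le> real n"
            using n' by (rule of_nat_mono)
          define y where "y = real n / (2 * real (Suc a))"
          have "1 \<le> y"
            using \<open>real (2 * Suc a) \<le> real n\<close> by (simp add: y_def le_divide_eq)
          moreover have "real n / real (Suc a) = 2 * y"
            by (simp add: y_def del: of_nat_Suc)
          ultimately show ?thesis
            by (simp only: y_def[symmetric])
        qed
        have "\<epsilon>\<^sub>1 ^ a / (2 * real (Suc a)) * real n * real n ^ a
            = \<epsilon>\<^sub>1 ^ a * (real n ^ a * (real n / (2 * real (Suc a))))"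
          by simp
        also have "\<dots> \<le> \<epsilon>\<^sub>1 ^ a * (real n ^ a * (real n / real (Suc a) - 1))"
          using half pos by (intro mult_left_mono) auto
        also have "\<dots> = \<epsilon>\<^sub>1 ^ a * (real n ^ Suc a / real (Suc a) - real n ^ a)"
          by (simp add: algebra_simps)
        also have "\<dots> \<le> \<epsilon>\<^sub>1 ^ a * (\<Sum>k=1..<n. real k ^ a)"
          unfolding sum_powers_from_1[OF \<open>a > 0\<close>]
          using pos by (intro mult_left_mono sum_powers_bounds(1)) auto
        also have "\<dots> = (\<Sum>k=1..<n. (\<epsilon>\<^sub>1 * real k) ^ a)"
          by (simp add: sum_distrib_left power_mult_distrib)
        also have "\<dots> \<le> (\<Sum>k=1..<n. gamma_shifted_moment \<epsilon>\<^sub>1 a (real k))"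
          by (intro sum_mono lower)
        finally have "\<epsilon>\<^sub>1 ^ a / (2 * real (Suc a)) * real n \<le> E n"
          using n by (simp add: E pos_le_divide_eq)
        then show "\<epsilon>\<^sub>1 ^ a / (2 * real (Suc a)) * norm (real n) \<le> norm (E n)"
          by simp
      qed
    qed
  }
qed

end
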